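(* Let $\{\xi_n\}_{n\ge 1}$ be a non-singular sequence of independent real random variables with finite second moments that satisfies the condition of uniform convergence, i.e. $\sup_{n}\alpha_n(s)\to 0$ as $s\to\infty$. Then the sequence of normalized sums $\widetilde S_n = (S_n - E S_n)/B_n$ converges in distribution to the standard normal random variable $\mathcal N(0,1)$ as $n\to\infty$ if and only if the total variance increases indefinitely, i.e. $B_n^2\to\infty$ as $n\to\infty$.
   Context: For a sequence $\{\xi_n\}_{n\ge1}$ of independent real random variables with finite second moments, let $F_n$ be the distribution function of $\xi_n$, $m_n = E\xi_n$, $\sigma_n^2 = D\xi_n$ (the variance of $\xi_n$), $S_n = \xi_1+\cdots+\xi_n$, and let $B_n^2 = D S_n = \sigma_1^2+\cdots+\sigma_n^2$ be the total variance, with $B_n\ge 0$. The normalized sum is $\widetilde S_n = (S_n - E S_n)/B_n$, defined for those $n$ with $B_n>0$ (for a non-singular sequence, as defined below, this holds for all sufficiently large $n$). For $s\ge 0$ define $\alpha_n(s)=0$ if $\sigma_n=0$, and $$\alpha_n(s)=\frac{1}{\sigma_n^2}\int_{|x-m_n|\ge s}|x-m_n|^2\,dF_n(x)\quad\text{if }\sigma_n>0.$$ The sequence $\{\xi_n\}$ satisfies the condition of uniform convergence if the random variables have finite second moments and the functions $\alpha_n(s)$ tend to zero as $s\to\infty$ uniformly in $n$, i.e. $\sup_n\alpha_n(s)\to0$ as $s\to\infty$. The sequence $\{\xi_n\}$ is called singular if every member $\xi_n$ has a degenerate distribution (almost surely constant) or a normal distribution; it is non-singular otherwise, i.e. if at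 least one $\xi_n$ has a distribution that is neither degenerate nor normal. *)

theory Defs
  imports "HOL-Probability.Probability"
begin

text \<open>Sequences are indexed by \<^term>\<open>{1::nat..}\<close>; the value at index 0 is never used.\<close>

definition partial_sum :: "(nat \<Rightarrow> 'a \<Rightarrow> real) \<Rightarrow> nat \<Rightarrow> 'a \<Rightarrow> real" where
  "partial_sum \<xi> n = (\<lambda>\<omega>. \<Sum>k=1..n. \<xi> k \<omega>)"

definition total_variance :: "'a measure \<Rightarrow> (nat \<Rightarrow> 'a \<Rightarrow> real) \<Rightarrow> nat \<Rightarrow> real" where
  "total_variance M \<xi> n = prob_space.variance M (partial_sum \<xi> n)"

text \<open>If the total variance vanishes, the quotient below is 0 by the convention for division by
  zero. For a non-singular sequence this concerns finitely many \<open>n\<close> only, hence does not affect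
  limits.\<close>

definition normalized_sum :: "'a measure \<Rightarrow> (nat \<Rightarrow> 'a \<Rightarrow> real) \<Rightarrow> nat \<Rightarrow> 'a \<Rightarrow> real" where
  "normalized_sum M \<xi> n = (\<lambda>\<omega>.
     (partial_sum \<xi> n \<omega> - prob_space.expectation M (partial_sum \<xi> n)) / sqrt (total_variance M \<xi> n))"

text \<open>The integral with respect to the distribution function of \<open>\<xi>\<^sub>n\<close> is the integral
  with respect to the law of \<open>\<xi>\<^sub>n\<close>.\<close>

definition tail_ratio :: "'a measure \<Rightarrow> (nat \<Rightarrow> 'a \<Rightarrow> real) \<Rightarrow> nat \<Rightarrow> real \<Rightarrow> real" where
  "tail_ratio M \<xi> n s =
     (let m = prob_space.expectation M (\<xi> n); v = prob_space.variance M (\<xi> n) in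
      if v = 0 then 0
      else (LINT x:{x. \<bar>x - m\<bar> \<ge> s}|distr M borel (\<xi> n). \<bar>x - m\<bar>\<^sup>2) / v)"

definition square_integrable_seq :: "'a measure \<Rightarrow> (nat \<Rightarrow> 'a \<Rightarrow> real) \<Rightarrow> bool" where
  "square_integrable_seq M \<xi> \<longleftrightarrow> (\<forall>n\<ge>1. integrable M (\<lambda>\<omega>. (\<xi> n \<omega>)\<^sup>2))"

text \<open>The supremum is taken in the reals; it is proper because the ratios lie between 0 and 1,
  see \<open>tail_ratio_nonneg\<close> and \<open>tail_ratio_le_1\<close> below.\<close>

definition uniform_convergence_condition :: "'a measure \<Rightarrow> (nat \<Rightarrow> 'a \<Rightarrow> real) \<Rightarrow> bool" where
  "uniform_convergence_condition M \<xi> \<longleftrightarrow>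
     square_integrable_seq M \<xi> \<and>
     ((\<lambda>s. SUP n\<in>{1..}. tail_ratio M \<xi> n s) \<longlongrightarrow> 0) at_top"

definition degenerate_rv :: "'a measure \<Rightarrow> ('a \<Rightarrow> real) \<Rightarrow> bool" where
  "degenerate_rv M X \<longleftrightarrow> (\<exists>c. AE \<omega> in M. X \<omega> = c)"

definition normal_rv :: "'a measure \<Rightarrow> ('a \<Rightarrow> real) \<Rightarrow> bool" where
  "normal_rv M X \<longleftrightarrow> (\<exists>\<mu> \<sigma>. \<sigma> > 0 \<and> distributed M lborel X (normal_density \<mu> \<sigma>))"

definition singular_seq :: "'a measure \<Rightarrow> (nat \<Rightarrow> 'a \<Rightarrow> real) \<Rightarrow> bool" where
  "singular_seq M \<xi> \<longleftrightarrow> (\<forall>n\<ge>1. degenerate_rv M (\<xi> n) \<or> normal_rv M (\<xi> n))"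

lemma tail_ratio_nonneg: "0 \<le> tail_ratio M \<xi> n s"
  unfolding tail_ratio_def Let_def set_lebesgue_integral_def
  by (auto intro!: divide_nonneg_nonneg Bochner_Integration.integral_nonneg)

lemma tail_ratio_le_1:
  assumes "prob_space M" and rv: "\<xi> n \<in> borel_measurable M"
    and sq: "integrable M (\<lambda>\<omega>. (\<xi> n \<omega>)\<^sup>2)"
  shows "tail_ratio M \<xi> n s \<le> 1"
proof -
  interpret prob_space M by fact
  note [measurable] = rv
  define m where "m = expectation (\<xi> n)"
  have "integrable M (\<xi> n)"
    by (rule square_integrable_imp_integrable[OF rv sq])
  then have int: "integrable M (\<lambda>\<omega>. (\<xi> n \<omega> - m)\<^sup>2)"
    using sq by (simp add: power2_diff)
  have "(LINT x:{x. \<bar>x - m\<bar> \<ge> s}|distr M borel (\<xi> n). \<bar>x - m\<bar>\<^sup>2)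
      \<le> (LINT x|distr M borel (\<xi> n). (x - m)\<^sup>2)"
    unfolding set_lebesgue_integral_def
    by (rule integral_mono') (auto simp: integrable_distr_eq int indicator_def)
  also have "\<dots> = variance (\<xi> n)"
    by (simp add: integral_distr m_def)
  finally have le: "(LINT x:{x. \<bar>x - m\<bar> \<ge> s}|distr M borel (\<xi> n). \<bar>x - m\<bar>\<^sup>2) \<le> variance (\<xi> n)" .
  have "(if v = 0 then 0 else I / v) \<le> 1" if "I \<le> v" "0 \<le> v" for I v :: real
    using that by (auto simp: divide_le_eq_1)
  from this[OF le variance_positive] show ?thesis
    unfolding tail_ratio_def Let_def m_def .
qed

end

theory Submission
  imports Defs "HOL-Complex_Analysis.Complex_Analysis"
begin

text \<open>
  Sufficiency is Lindeberg's argument. Uniform convergence bounds the variances \<open>\<sigma>\<^sub>k\<^sup>2\<close>, so every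
  summand becomes negligible once \<open>B\<^sub>n \<rightarrow> \<infinity>\<close>, and the Lindeberg sum at level \<open>\<epsilon>\<close> is at most
  \<open>sup\<^sub>k \<alpha>\<^sub>k(\<epsilon> B\<^sub>n)\<close>. The characteristic function of the normalized sum is then compared factor by
  factor with the Gaussian one.

  Necessity rests on Cramer's decomposition theorem. If \<open>B\<^sub>n\<close> stays bounded, then it converges; split off
  a summand \<open>\<xi>\<^sub>j\<close> that is neither degenerate nor normal. The normalized sum of the remaining summands
  is tight, and a subsequential weak limit of it is an independent complement of the rescaled \<open>\<xi>\<^sub>j\<close>
  in a standard normal law, so \<open>\<xi>\<^sub>j\<close> would be normal or degenerate. Cramer's theorem itself holds
  because the moment generating function of a factor of a normal law is entire, has no zeros and grows
  at most like \<open>exp (C |z|\<^sup>2)\<close>, hence is the exponential of a quadratic polynomial.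
\<close>

section \<open>Zero-free entire functions of order two\<close>

text \<open>Turns a one-sided bound on the real part into a bound on the modulus. This is the form
  required for a logarithm, since the growth of an entire function controls only the real part of
  its logarithm.\<close>

lemma borel_caratheodory_zero:
  fixes h :: "complex \<Rightarrow> complex"
  assumes holo: "h holomorphic_on ball 0 R" and h0: "h 0 = 0"
    and Re_less: "\<And>z. norm z < R \<Longrightarrow> Re (h z) < A" and z: "norm z < R"
  shows "norm (h z) \<le> 2 * A * norm z / (R - norm z)"
proof -
  have R: "R > 0" using z norm_ge_zero[of z] by linarith
  have A: "A > 0" using Re_less[of 0] R h0 by simp
  have nz: "2 * of_real A - h z \<noteq> 0" if "norm z < R" for z
  proof
    assume "2 * of_real A - h z = 0"
    then have "Re (h z) = 2 * A" by (simp add: complex_eq_iff)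
    with Re_less[OF that] A show False by simp
  qed
  \<comment> \<open>\<open>u \<mapsto> u / (2 A - u)\<close> maps the half-plane \<open>Re u < A\<close> into the unit disc, so Schwarz's lemma applies\<close>
  define g where "g w = h (of_real R * w) / (2 * of_real A - h (of_real R * w))" for w
  have in_ball: "norm (of_real R * w) < R" if "norm w < 1" for w :: complex
    using that R by (simp add: norm_mult)
  have "norm (g (z / of_real R)) \<le> norm (z / of_real R)"
  proof (rule Schwarz_Lemma(1))
    have "(\<lambda>w. h (of_real R * w)) holomorphic_on ball 0 1"
      using in_ball
      by (intro holomorphic_on_compose_gen[OF _ holo, unfolded comp_def] holomorphic_intros) auto
    then show "g holomorphic_on ball 0 1"
      unfolding g_def using nz in_ball by (intro holomorphic_intros) auto
    show "g 0 = 0" by (simp add: g_def h0)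
    show "norm (g w) < 1" if "norm w < 1" for w
    proof -
      let ?u = "h (of_real R * w)"
      have "Re ?u < A" using Re_less in_ball[OF that] .
      \<comment> \<open>Expanding gives |2 A - u|^2 - |u|^2 = 4 A^2 - 4 A Re u, which is positive
        exactly because Re u < A.\<close>
      then have "4 * A * Re ?u < 4 * A * A" using A by simp
      then have "(norm ?u)\<^sup>2 < (norm (2 * of_real A - ?u))\<^sup>2"
        by (simp add: cmod_power2 power2_diff) (simp add: power2_eq_square algebra_simps)
      then have "norm ?u < norm (2 * of_real A - ?u)"
        by (rule power_less_imp_less_base) simp
      then show ?thesis unfolding g_def by (simp add: norm_divide divide_less_eq_1)
    qed
    show "norm (z / of_real R) < 1" using z R by (simp add: norm_divide)
  qed
  then have "norm (h z) / norm (2 * of_real A - h z) \<le> norm z / R"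
    using R by (simp add: g_def norm_divide)
  then have "norm (h z) \<le> norm z / R * norm (2 * of_real A - h z)"
    using nz[OF z] by (simp add: divide_le_eq)
  also have "\<dots> \<le> norm z / R * (2 * A + norm (h z))"
    using R A norm_triangle_ineq4[of "2 * of_real A" "h z"] by (intro mult_left_mono) (auto simp: norm_mult)
  finally have "norm (h z) * (R - norm z) \<le> 2 * A * norm z"
    using R by (simp add: field_simps)
  then show ?thesis using z by (simp add: field_simps)
qed

text \<open>The zero-free case of Hadamard's factorization. An entire logarithm has real part of at
  most quadratic growth, hence by Borel-Caratheodory modulus of at most quadratic growth, and
  Liouville's theorem makes it a polynomial of degree at most two. The value 1 at the origin removes
  the constant term.\<close>

lemma nonvanishing_entire_order_two:
  fixes f :: "complex \<Rightarrow> complex"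
  assumes holo: "f holomorphic_on UNIV" and nz: "\<And>z. f z \<noteq> 0" and f0: "f 0 = 1"
    and growth: "\<And>z. norm (f z) \<le> K * exp (C * (norm z)\<^sup>2)"
  obtains a b where "\<And>z. f z = exp (a * z + b * z\<^sup>2)"
proof -
  obtain g where g: "g holomorphic_on UNIV" "\<And>z. exp (g z) = f z"
    using holomorphic_logarithm_exists[of UNIV f 0] holo nz by auto
  define h where "h z = g z - g 0" for z
  have h0: "h 0 = 0" and exp_h: "exp (h z) = f z" for z
    using g(2)[of z] g(2)[of 0] f0 by (auto simp: h_def exp_diff)
  have holo_h: "h holomorphic_on UNIV"
    unfolding h_def by (intro holomorphic_intros g)
  have K: "K \<ge> 1" using growth[of 0] f0 by simp
  have Re_h: "Re (h z) \<le> ln K + C * (norm z)\<^sup>2" for z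
  proof -
    have "exp (Re (h z)) \<le> exp (ln K + C * (norm z)\<^sup>2)"
      using growth[of z] exp_h[of z] K by (simp add: exp_add norm_exp_eq_Re[symmetric])
    then show ?thesis by simp
  qed
  \<comment> \<open>Borel-Caratheodory is applied on the disc of radius 2 |z|: there
    \<open>C * (norm w)\<^sup>2\<close> is at most 4 |C| |z|^2, and the factor |z| / (2 |z| - |z|)
    is 1. The summand 1 makes the bound on the real part strict, and |z| >= 1 absorbs the constants
    into |z|^2.\<close>
  define D where "D = ln K + 1 + \<bar>C\<bar> * 4"
  have D: "norm (h z) \<le> (2 * D) * norm z ^ 2" if z: "1 \<le> norm z" for z
  proof -
    have r2: "1 \<le> (norm z)\<^sup>2" using z by (simp add: one_le_power)
    have lnK: "0 \<le> ln K" using K by simp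
    define A where "A = D * (norm z)\<^sup>2"
    have "Re (h w) < A" if w: "norm w < 2 * norm z" for w
    proof -
      have "C * (norm w)\<^sup>2 \<le> \<bar>C\<bar> * (2 * norm z)\<^sup>2"
        using w by (intro mult_mono power_mono) auto
      then have "Re (h w) < ln K + 1 + \<bar>C\<bar> * 4 * (norm z)\<^sup>2"
        using Re_h[of w] by (simp add: power_mult_distrib algebra_simps)
      also have "\<dots> \<le> A"
        using mult_left_mono[OF r2, of "ln K + 1"] lnK by (simp add: A_def D_def algebra_simps)
      finally show ?thesis .
    qed
    then have "norm (h z) \<le> 2 * A * norm z / (2 * norm z - norm z)"
      using z holo_h by (intro borel_caratheodory_zero h0) (auto intro: holomorphic_on_subset)
    also have "\<dots> = 2 * A" using z by auto
    finally show ?thesis by (simp add: A_def)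
  qed
  have "h z = deriv h 0 * z + (deriv ^^ 2) h 0 / 2 * z\<^sup>2" for z
    using Liouville_polynomial[OF holo_h D, where \<xi>=z] h0
    by (simp add: numeral_2_eq_2)
  then show ?thesis using that[of "deriv h 0" "(deriv ^^ 2) h 0 / 2"] exp_h by metis
qed

section \<open>Cramer's decomposition theorem\<close>

text \<open>A complex argument unites the characteristic function, found on the imaginary axis, with
  the real moment generating function. Where the integrand is not integrable the value is 0 by
  convention, so analyticity is claimed only under finite exponential moments.\<close>

definition complex_mgf :: "real measure \<Rightarrow> complex \<Rightarrow> complex" where
  "complex_mgf \<mu> z = (\<integral>x. exp (z * of_real x) \<partial>\<mu>)"

lemma complex_mgf_imaginary: "complex_mgf \<mu> (\<i> * of_real t) = char \<mu> t"
  by (simp add: complex_mgf_def char_def mult.assoc)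

section \<open>Analyticity and growth of the moment generating function\<close>

context real_distribution
begin

lemma integrable_exp_abs:
  assumes "\<And>t. integrable M (\<lambda>x. exp (t * x))"
  shows "integrable M (\<lambda>x. exp (r * \<bar>x\<bar>))"
proof (rule Bochner_Integration.integrable_bound)
  show "integrable M (\<lambda>x. exp (r * x) + exp (- r * x))"
    by (intro Bochner_Integration.integrable_add assms)
  have "exp (r * \<bar>x\<bar>) \<le> exp (r * x) + exp (- r * x)" for x
    by (cases "x < 0") auto
  then show "AE x in M. norm (exp (r * \<bar>x\<bar>)) \<le> norm (exp (r * x) + exp (- r * x))"
    by (auto intro!: AE_I2 order_trans[OF _ abs_ge_self])
qed measurable

text \<open>The exponential series is integrated term by term. All partial sums of the norms lie
  below exp (|z| |x|), whose integrability yields both the integrability of each term and the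
  summability of the integrals.\<close>

lemma complex_mgf_power_series:
  assumes int: "\<And>t. integrable M (\<lambda>x. exp (t * x))"
  shows "(\<lambda>n. of_real ((\<integral>x. x ^ n \<partial>M) / fact n) * z ^ n) sums complex_mgf M z"
proof -
  let ?f = "\<lambda>n x. (z * complex_of_real x) ^ n /\<^sub>R fact n"
  have norm_f: "norm (?f n x) = (norm z * \<bar>x\<bar>) ^ n / fact n" for n x
    by (simp add: norm_mult norm_power divide_inverse)
  have partial_le: "(\<Sum>i<n. norm (?f i x)) \<le> exp (norm z * \<bar>x\<bar>)" for n x
    unfolding norm_f exp_def
    by (intro sum_le_suminf[THEN order_trans]) 
       (auto simp: divide_inverse ac_simps intro!: suminf_le summable_exp)
  note int_exp = integrable_exp_abs[OF int, of "norm z"]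
  have int_f: "integrable M (?f n)" for n
  proof (rule Bochner_Integration.integrable_bound[OF int_exp])
    show "AE x in M. norm (?f n x) \<le> norm (exp (norm z * \<bar>x\<bar>))"
    proof (rule AE_I2)
      fix x
      have "norm (?f n x) \<le> (\<Sum>i<Suc n. norm (?f i x))"
        by (simp add: sum_nonneg)
      also have "\<dots> \<le> exp (norm z * \<bar>x\<bar>)" by (rule partial_le)
      finally show "norm (?f n x) \<le> norm (exp (norm z * \<bar>x\<bar>))" by simp
    qed
  qed measurable
  have "(\<lambda>n. integral\<^sup>L M (?f n)) sums (\<integral>x. (\<Sum>n. ?f n x) \<partial>M)"
  proof (rule sums_integral[OF int_f])
    show "AE x in M. summable (\<lambda>n. norm (?f n x))"
      using summable_norm_exp by blast
    show "summable (\<lambda>n. \<integral>x. norm (?f n x) \<partial>M)"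
    proof (rule summableI_nonneg_bounded)
      fix n
      have "(\<Sum>i<n. \<integral>x. norm (?f i x) \<partial>M) = (\<integral>x. (\<Sum>i<n. norm (?f i x)) \<partial>M)"
        by (intro Bochner_Integration.integral_sum[symmetric] integrable_norm int_f)
      also have "\<dots> \<le> (\<integral>x. exp (norm z * \<bar>x\<bar>) \<partial>M)"
        by (intro integral_mono int_exp partial_le Bochner_Integration.integrable_sum integrable_norm int_f)
      finally show "(\<Sum>i<n. \<integral>x. norm (?f i x) \<partial>M) \<le> (\<integral>x. exp (norm z * \<bar>x\<bar>) \<partial>M)" .
    qed auto
  qed
  also have "(\<lambda>x. \<Sum>n. ?f n x) = (\<lambda>x. exp (z * complex_of_real x))"
    by (simp add: exp_def)
  also have "(\<lambda>n. integral\<^sup>L M (?f n)) = (\<lambda>n. of_real ((\<integral>x. x ^ n \<partial>M) / fact n) * z ^ n)"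
  proof
    fix n
    have "?f n x = (z ^ n / fact n) * complex_of_real (x ^ n)" for x
      by (simp add: power_mult_distrib scaleR_conv_of_real divide_inverse)
    then show "integral\<^sup>L M (?f n) = of_real ((\<integral>x. x ^ n \<partial>M) / fact n) * z ^ n"
      by (simp add: integral_complex_of_real del: of_real_power)
  qed
  finally show ?thesis by (simp add: complex_mgf_def)
qed

lemma complex_mgf_holomorphic:
  assumes "\<And>t. integrable M (\<lambda>x. exp (t * x))"
  shows "complex_mgf M holomorphic_on UNIV"
proof (rule holomorphic_on_subset[of _ "\<Union>r. ball 0 r"])
  have "complex_mgf M holomorphic_on ball 0 r" for r
    using complex_mgf_power_series[OF assms]
    by (intro power_series_holomorphic[where a = "\<lambda>n. of_real ((\<integral>x. x ^ n \<partial>M) / fact n)"]) simp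
  then show "complex_mgf M holomorphic_on (\<Union>r. ball 0 r)"
    by (intro holomorphic_on_UN_open) auto
qed (use gt_ex in auto)

text \<open>Reduces growth in the plane to growth on the real axis.\<close>

lemma norm_complex_mgf_le:
  "norm (complex_mgf M z) \<le> (\<integral>x. exp (Re z * x) \<partial>M)"
  unfolding complex_mgf_def
  by (rule integral_norm_bound[THEN order_trans]) simp

lemma complex_mgf_of_real:
  "complex_mgf M (of_real t) = of_real (\<integral>x. exp (t * x) \<partial>M)"
  unfolding complex_mgf_def integral_complex_of_real[symmetric]
  by (simp add: exp_of_real flip: of_real_mult)

lemma complex_mgf_0: "complex_mgf M 0 = 1"
  by (simp add: complex_mgf_def prob_space del: space_eq_univ)

end

section \<open>Exponential moments of the factors of a normal law\<close>

lemma nn_integral_exp_std_normal: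
  "(\<integral>\<^sup>+x. ennreal (exp (t * x)) \<partial>std_normal_distribution) = ennreal (exp (t\<^sup>2 / 2))"
proof -
  interpret N: prob_space "density lborel (normal_density t 1)"
    by (rule prob_space_normal_density) simp
  \<comment> \<open>Completing the square: tilting by exp (t x) shifts the mean of the standard
    normal density to t.\<close>
  have eq: "std_normal_density x * exp (t * x) = exp (t\<^sup>2 / 2) * normal_density t 1 x" for x
    by (simp add: normal_density_def exp_add[symmetric] field_simps power2_eq_square)
  have "(\<integral>\<^sup>+x. ennreal (exp (t * x)) \<partial>std_normal_distribution)
      = (\<integral>\<^sup>+x. ennreal (exp (t\<^sup>2 / 2)) * ennreal (normal_density t 1 x) \<partial>lborel)"
    by (subst nn_integral_density) (auto simp: ennreal_mult'[symmetric] eq)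
  also have "\<dots> = ennreal (exp (t\<^sup>2 / 2)) * (\<integral>\<^sup>+x. ennreal (normal_density t 1 x) \<partial>lborel)"
    by (rule nn_integral_cmult) auto
  also have "(\<integral>\<^sup>+x. ennreal (normal_density t 1 x) \<partial>lborel) = 1"
    using N.emeasure_space_1 by (simp add: emeasure_density)
  finally show ?thesis by simp
qed

text \<open>Realizes two laws as independent summands on their product space, where characteristic
  functions multiply; Levy's uniqueness theorem then identifies the law of the sum. This serves for
  factors that come only as measures, such as weak limits.\<close>

lemma convolution_eqI_char:
  assumes "real_distribution \<mu>" "real_distribution \<nu>" "real_distribution \<rho>"
    and char: "\<And>t. char \<mu> t * char \<nu> t = char \<rho> t"
  shows "distr (\<mu> \<Otimes>\<^sub>M \<nu>) borel (\<lambda>(x, y). x + y) = \<rho>"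
proof (rule Levy_uniqueness[OF _ assms(3)])
  interpret \<mu>: real_distribution \<mu> by fact
  interpret \<nu>: real_distribution \<nu> by fact
  interpret P: pair_prob_space \<mu> \<nu> ..
  let ?S = "distr (\<mu> \<Otimes>\<^sub>M \<nu>) borel (\<lambda>(x, y). x + y)"
  show "real_distribution ?S"
    by (intro P.real_distribution_distr) measurable
  have sum: "char ?S t = char \<mu> t * char \<nu> t" for t
  proof -
    have "char ?S t = (\<integral>p. iexp (t * (fst p + snd p)) \<partial>(\<mu> \<Otimes>\<^sub>M \<nu>))"
      unfolding char_def by (subst integral_distr) (auto simp: case_prod_beta)
    also have "\<dots> = (\<integral>x. \<integral>y. iexp (t * (x + y)) \<partial>\<nu> \<partial>\<mu>)"
      by (subst P.integral_fst'[symmetric]) (auto intro!: P.integrable_const_bound[of _ 1])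
    also have "\<dots> = (\<integral>x. iexp (t * x) * char \<nu> t \<partial>\<mu>)"
      by (simp add: char_def distrib_left exp_add)
    finally show ?thesis by (simp add: char_def)
  qed
  show "char ?S = char \<rho>" using sum char by auto
qed

text \<open>Tonelli's theorem on the product space. Nonnegative extended integrals are used because
  finiteness of the individual factors is still to be derived from this identity.\<close>

lemma nn_integral_exp_mult:
  assumes "real_distribution \<mu>" "real_distribution \<nu>"
    and char: "\<And>t. char \<mu> t * char \<nu> t = char std_normal_distribution t"
  shows "(\<integral>\<^sup>+x. ennreal (exp (t * x)) \<partial>\<mu>) * (\<integral>\<^sup>+x. ennreal (exp (t * x)) \<partial>\<nu>) = ennreal (exp (t\<^sup>2 / 2))"
proof -
  interpret \<mu>: real_distribution \<mu> by fact
  interpret \<nu>: real_distribution \<nu> by fact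
  interpret P: pair_prob_space \<mu> \<nu> ..
  have "ennreal (exp (t\<^sup>2 / 2))
      = (\<integral>\<^sup>+x. ennreal (exp (t * x)) \<partial>distr (\<mu> \<Otimes>\<^sub>M \<nu>) borel (\<lambda>(x, y). x + y))"
    unfolding convolution_eqI_char[OF assms(1,2) real_dist_normal_dist char] nn_integral_exp_std_normal ..
  also have "\<dots> = (\<integral>\<^sup>+p. ennreal (exp (t * (fst p + snd p))) \<partial>(\<mu> \<Otimes>\<^sub>M \<nu>))"
    by (subst nn_integral_distr) (auto simp: case_prod_beta)
  also have "\<dots> = (\<integral>\<^sup>+x. \<integral>\<^sup>+y. ennreal (exp (t * (x + y))) \<partial>\<nu> \<partial>\<mu>)"
    by (subst \<nu>.nn_integral_fst[symmetric]) auto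
  also have "\<dots> = (\<integral>\<^sup>+x. ennreal (exp (t * x)) * (\<integral>\<^sup>+y. ennreal (exp (t * y)) \<partial>\<nu>) \<partial>\<mu>)"
    by (intro nn_integral_cong) (auto simp: distrib_left exp_add ennreal_mult nn_integral_cmult)
  finally show ?thesis by (simp add: nn_integral_multc)
qed


text \<open>Some interval [-n, n] carries more than half of the mass, and there t x >= -|t| n. The
  same n works for every t, which keeps the later growth bound explicit.\<close>

lemma (in real_distribution) nn_integral_exp_lower_bound:
  obtains c where "\<And>t. ennreal (exp (- (\<bar>t\<bar> * c)) / 2) \<le> (\<integral>\<^sup>+x. ennreal (exp (t * x)) \<partial>M)"
proof -
  have "(\<lambda>n. prob {- real n..real n}) \<longlonglongrightarrow> prob (\<Union>n. {- real n..real n})"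
    by (intro finite_Lim_measure_incseq) (auto simp: incseq_def)
  moreover have "(\<Union>n. {- real n..real n}) = UNIV"
  proof (intro set_eqI iffI UNIV_I)
    fix x :: real
    obtain n :: nat where "\<bar>x\<bar> \<le> real n" using real_arch_simple by blast
    then show "x \<in> (\<Union>n. {- real n..real n})" by (auto simp: abs_le_iff intro!: exI[of _ n])
  qed
  ultimately have "(\<lambda>n. prob {- real n..real n}) \<longlonglongrightarrow> 1"
    using prob_space by simp
  from order_tendstoD(1)[OF this, of "1/2"] obtain n :: nat where n: "1/2 < prob {- real n..real n}"
    by (auto simp: eventually_sequentially)
  show ?thesis
  proof (rule that[of "real n"])
    fix t :: real
    have "ennreal (exp (- (\<bar>t\<bar> * real n)) / 2) \<le> ennreal (exp (- (\<bar>t\<bar> * real n)) * prob {- real n..real n})"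
      using n by (intro ennreal_leI) simp
    also have "\<dots> = (\<integral>\<^sup>+x. ennreal (exp (- (\<bar>t\<bar> * real n))) * indicator {- real n..real n} x \<partial>M)"
      by (subst nn_integral_cmult_indicator) (auto simp: emeasure_eq_measure ennreal_mult')
    also have "\<dots> \<le> (\<integral>\<^sup>+x. ennreal (exp (t * x)) \<partial>M)"
    proof (rule nn_integral_mono)
      fix x :: real
      have "- (\<bar>t\<bar> * real n) \<le> t * x" if "x \<in> {- real n..real n}"
      proof -
        have "\<bar>t * x\<bar> \<le> \<bar>t\<bar> * real n"
          using that by (auto simp: abs_mult intro!: mult_left_mono)
        then show ?thesis by linarith
      qed
      then show "ennreal (exp (- (\<bar>t\<bar> * real n))) * indicator {- real n..real n} x \<le> ennreal (exp (t * x))"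
        by (auto simp: indicator_def intro!: ennreal_leI)
    qed
    finally show "ennreal (exp (- (\<bar>t\<bar> * real n)) / 2) \<le> (\<integral>\<^sup>+x. ennreal (exp (t * x)) \<partial>M)" .
  qed
qed

text \<open>The product of the two exponential moments is exp (t^2 / 2) and the second one has a
  positive lower bound, so the first one is finite and bounded by their quotient.\<close>

lemma normal_factor_mgf_bound:
  assumes \<mu>: "real_distribution \<mu>" and \<nu>: "real_distribution \<nu>"
    and char: "\<And>t. char \<mu> t * char \<nu> t = char std_normal_distribution t"
  obtains c where "\<And>t. integrable \<mu> (\<lambda>x. exp (t * x))"
    and "\<And>t. (\<integral>x. exp (t * x) \<partial>\<mu>) \<le> 2 * exp (\<bar>t\<bar> * c + t\<^sup>2 / 2)"
proof -
  interpret \<mu>: real_distribution \<mu> by fact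
  interpret \<nu>: real_distribution \<nu> by fact
  obtain c where c: "\<And>t. ennreal (exp (- (\<bar>t\<bar> * c)) / 2) \<le> (\<integral>\<^sup>+x. ennreal (exp (t * x)) \<partial>\<nu>)"
    using \<nu>.nn_integral_exp_lower_bound by blast
  have bound: "(\<integral>\<^sup>+x. ennreal (exp (t * x)) \<partial>\<mu>) \<le> ennreal (2 * exp (\<bar>t\<bar> * c + t\<^sup>2 / 2))" for t
  proof -
    define E where "E = (\<integral>\<^sup>+x. ennreal (exp (t * x)) \<partial>\<mu>)"
    have "E * ennreal (exp (- (\<bar>t\<bar> * c)) / 2) \<le> ennreal (exp (t\<^sup>2 / 2))"
      unfolding E_def nn_integral_exp_mult[OF \<mu> \<nu> char, symmetric] by (intro mult_left_mono c) simp
    \<comment> \<open>Multiplying by the reciprocal of the lower bound replaces a division of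
      extended reals.\<close>
    then have "ennreal (2 * exp (\<bar>t\<bar> * c)) * (E * ennreal (exp (- (\<bar>t\<bar> * c)) / 2))
        \<le> ennreal (2 * exp (\<bar>t\<bar> * c)) * ennreal (exp (t\<^sup>2 / 2))"
      by (rule mult_left_mono) simp
    also have "ennreal (2 * exp (\<bar>t\<bar> * c)) * (E * ennreal (exp (- (\<bar>t\<bar> * c)) / 2))
        = E * ennreal (2 * exp (\<bar>t\<bar> * c) * (exp (- (\<bar>t\<bar> * c)) / 2))"
      by (subst ennreal_mult) (auto simp: ac_simps)
    also have "2 * exp (\<bar>t\<bar> * c) * (exp (- (\<bar>t\<bar> * c)) / 2) = 1"
      by (simp add: exp_minus)
    finally have "E \<le> ennreal (2 * exp (\<bar>t\<bar> * c)) * ennreal (exp (t\<^sup>2 / 2))"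
      by simp
    then show ?thesis by (simp add: E_def ennreal_mult'[symmetric] exp_add mult.assoc)
  qed
  show ?thesis
  proof (rule that[of c])
    fix t
    show int: "integrable \<mu> (\<lambda>x. exp (t * x))"
      using bound[of t] by (intro integrableI_bounded) (auto simp: less_top[symmetric] top_unique)
    have "ennreal (\<integral>x. exp (t * x) \<partial>\<mu>) \<le> ennreal (2 * exp (\<bar>t\<bar> * c + t\<^sup>2 / 2))"
      using bound[of t] int by (subst nn_integral_eq_integral[symmetric]) auto
    then show "(\<integral>x. exp (t * x) \<partial>\<mu>) \<le> 2 * exp (\<bar>t\<bar> * c + t\<^sup>2 / 2)"
      by (simp add: ennreal_le_iff)
  qed
qed

section \<open>From zero-free entire functions to normal laws\<close>

lemma real_valued_exp_quadratic:
  fixes a b :: complex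
  assumes "\<And>t :: real. exp (a * of_real t + b * (of_real t)\<^sup>2) \<in> \<real>"
  shows "a \<in> \<real>" "b \<in> \<real>"
proof -
  let ?\<theta> = "\<lambda>t. Im a * t + Im b * t\<^sup>2"
  have sin0: "sin (?\<theta> t) = 0" for t :: real
  proof -
    have "Im (exp (a * of_real t + b * (of_real t)\<^sup>2)) = 0"
      using assms[of t] by (simp add: complex_is_Real_iff)
    then show ?thesis by (simp add: Im_exp power2_eq_square)
  qed
  \<comment> \<open>At t = pi / (2 |y|) the sine would be 1 or -1. Only positive t are tested,
    because for the quadratic coefficient t stands for the square of a real number.\<close>
  have vanish: "y = 0" if "\<And>t. t > 0 \<Longrightarrow> sin (y * t) = 0" for y :: real
  proof (rule ccontr)
    assume "y \<noteq> 0"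
    then have "y * (pi / (2 * \<bar>y\<bar>)) = pi / 2 \<or> y * (pi / (2 * \<bar>y\<bar>)) = - (pi / 2)"
      by (auto simp: abs_if)
    moreover have "sin (y * (pi / (2 * \<bar>y\<bar>))) = 0"
      using \<open>y \<noteq> 0\<close> by (intro that) auto
    ultimately show False by (metis neg_equal_0_iff_equal sin_minus sin_pi_half zero_neq_one)
  qed
  \<comment> \<open>The difference of the phases at t and -t isolates the linear term; their sum,
    used below, isolates the quadratic one.\<close>
  have "sin (2 * Im a * t) = 0" for t
    using sin0[of t] sin0[of "-t"] sin_diff[of "?\<theta> t" "?\<theta> (-t)"] by (simp add: ac_simps)
  then show "a \<in> \<real>" using vanish[of "2 * Im a"] by (simp add: complex_is_Real_iff)
  have "sin (2 * Im b * t\<^sup>2) = 0" for t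
    using sin0[of t] sin0[of "-t"] sin_add[of "?\<theta> t" "?\<theta> (-t)"] by (simp add: ac_simps)
  then have "sin (2 * Im b * t) = 0" if "t > 0" for t
    using that by (metis less_imp_le real_sqrt_pow2)
  then show "b \<in> \<real>" using vanish[of "2 * Im b"] by (simp add: complex_is_Real_iff)
qed

text \<open>Along z = i t the term b z^2 becomes -b t^2, so the exponential of a quadratic reads as
  a normal characteristic function with variance 2 b. The case b = 0 is the point mass at a.\<close>

theorem cramer_decomposition_std_normal:
  assumes \<mu>: "real_distribution \<mu>" and \<nu>: "real_distribution \<nu>"
    and char: "\<And>t. char \<mu> t * char \<nu> t = char std_normal_distribution t"
  obtains a b :: real where "b \<ge> 0" "\<And>t. char \<mu> t = iexp (t * a) * of_real (exp (- (b * t\<^sup>2)))"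
proof -
  interpret \<mu>: real_distribution \<mu> by fact
  interpret \<nu>: real_distribution \<nu> by fact
  obtain c where int_\<mu>: "\<And>t. integrable \<mu> (\<lambda>x. exp (t * x))"
    and c: "\<And>t. (\<integral>x. exp (t * x) \<partial>\<mu>) \<le> 2 * exp (\<bar>t\<bar> * c + t\<^sup>2 / 2)"
    using normal_factor_mgf_bound[OF assms] by blast
  have int_\<nu>: "integrable \<nu> (\<lambda>x. exp (t * x))" for t
    using normal_factor_mgf_bound[OF \<nu> \<mu>] char by (metis mult.commute)
  let ?F = "complex_mgf \<mu>" and ?G = "complex_mgf \<nu>"
  have holo: "?F holomorphic_on UNIV" "?G holomorphic_on UNIV"
    by (intro \<mu>.complex_mgf_holomorphic int_\<mu>, intro \<nu>.complex_mgf_holomorphic int_\<nu>)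
  \<comment> \<open>The hypothesis gives this identity on the imaginary axis only. The axis
    accumulates at 0, so the identity theorem extends it to the plane, where it shows that
    \<open>?F\<close> has no zeros.\<close>
  have "?F z * ?G z - exp (z\<^sup>2 / 2) = 0" for z
  proof (rule analytic_continuation[of "\<lambda>z. ?F z * ?G z - exp (z\<^sup>2 / 2)" UNIV "range (\<lambda>t. \<i> * complex_of_real t)" 0])
    show "(\<lambda>z. ?F z * ?G z - exp (z\<^sup>2 / 2)) holomorphic_on UNIV"
      by (intro holomorphic_intros holo) auto
    show "(0::complex) islimpt range (\<lambda>t. \<i> * complex_of_real t)"
      unfolding islimpt_approachable
    proof (intro allI impI)
      fix e :: real assume "e > 0"
      then have "\<i> * complex_of_real (e / 2) \<noteq> 0 \<and> dist (\<i> * complex_of_real (e / 2)) 0 < e"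
        by (auto simp: norm_mult)
      then show "\<exists>x'\<in>range (\<lambda>t. \<i> * complex_of_real t). x' \<noteq> 0 \<and> dist x' 0 < e"
        by blast
    qed
    show "?F z * ?G z - exp (z\<^sup>2 / 2) = 0" if "z \<in> range (\<lambda>t. \<i> * complex_of_real t)" for z
    proof -
      from that obtain t where t: "z = \<i> * complex_of_real t" by blast
      have "z\<^sup>2 / 2 = complex_of_real (- (t\<^sup>2) / 2)" by (simp add: t power_mult_distrib)
      then have "exp (z\<^sup>2 / 2) = complex_of_real (exp (- (t\<^sup>2) / 2))" by (simp only: exp_of_real)
      then show ?thesis
        using char[of t] by (simp add: t complex_mgf_imaginary char_std_normal_distribution)
    qed
  qed auto
  then have nz: "?F z \<noteq> 0" for z
    by (metis exp_not_eq_zero mult_zero_left right_minus_eq)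
  have growth: "norm (?F z) \<le> (2 * exp (c\<^sup>2 / 2)) * exp (1 * (norm z)\<^sup>2)" for z
  proof -
    \<comment> \<open>Completing the square absorbs the linear exponent |Re z| c into the quadratic
      one, at the cost of the constant factor exp (c^2 / 2).\<close>
    have "0 \<le> (\<bar>Re z\<bar> - c)\<^sup>2" by simp
    then have *: "\<bar>Re z\<bar> * c \<le> c\<^sup>2 / 2 + (Re z)\<^sup>2 / 2"
      by (simp add: power2_diff)
    have "norm (?F z) \<le> 2 * exp (\<bar>Re z\<bar> * c + (Re z)\<^sup>2 / 2)"
      using \<mu>.norm_complex_mgf_le c order_trans by blast
    also have "\<dots> \<le> 2 * exp (c\<^sup>2 / 2 + (norm z)\<^sup>2)"
      using * abs_Re_le_cmod[of z] power_mono[of "\<bar>Re z\<bar>" "norm z" 2] by simp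
    finally show ?thesis by (simp only: exp_add mult_1 mult.assoc)
  qed
  obtain a b where ab: "\<And>z. ?F z = exp (a * z + b * z\<^sup>2)"
    using nonvanishing_entire_order_two[OF holo(1) nz \<mu>.complex_mgf_0 growth] by blast
  have "exp (a * of_real t + b * (of_real t)\<^sup>2) \<in> \<real>" for t :: real
    unfolding ab[symmetric] \<mu>.complex_mgf_of_real by simp
  from real_valued_exp_quadratic[OF this] obtain a' b' where a': "a = of_real a'" and b': "b = of_real b'"
    by (auto elim!: Reals_cases)
  have char_\<mu>: "char \<mu> t = iexp (t * a') * of_real (exp (- (b' * t\<^sup>2)))" for t
  proof -
    have "of_real a' * (\<i> * of_real t) + of_real b' * (\<i> * of_real t)\<^sup>2
        = \<i> * of_real (t * a') + complex_of_real (- (b' * t\<^sup>2))"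
      by (simp add: power_mult_distrib)
    then show ?thesis
      unfolding complex_mgf_imaginary[symmetric] ab a' b' by (simp only: exp_add exp_of_real)
  qed
  \<comment> \<open>A characteristic function is bounded by 1; its value at t = 1 decides the sign
    of \<open>b'\<close>.\<close>
  have "exp (- b') \<le> 1"
    using \<mu>.cmod_char_le_1[of 1] by (simp add: char_\<mu> norm_mult)
  then show ?thesis using that char_\<mu> by simp
qed

section \<open>Characteristic functions of sums\<close>

text \<open>Both sides come from exp u >= 1 + u: the lower one directly, the upper one because the
  same inequality makes the derivative of the difference nonnegative.\<close>

lemma abs_exp_minus_taylor1:
  fixes x :: real
  assumes "x \<ge> 0"
  shows "\<bar>exp (- x) - (1 - x)\<bar> \<le> x\<^sup>2 / 2"
proof -
  let ?f = "\<lambda>x :: real. 1 - x + x\<^sup>2 / 2 - exp (- x)"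
  have "?f 0 \<le> ?f x"
  proof (rule DERIV_nonneg_imp_nondecreasing[OF assms])
    show "\<exists>y. (?f has_real_derivative y) (at u) \<and> 0 \<le> y" for u :: real
      using exp_ge_add_one_self[of "- u"]
      by (intro exI[of _ "- 1 + u + exp (- u)"]) (auto intro!: derivative_eq_intros)
  qed
  then show ?thesis using exp_ge_add_one_self[of "- x"] by simp
qed

context prob_space
begin

lemma variance_sum_indep:
  fixes X :: "'i \<Rightarrow> 'a \<Rightarrow> real"
  assumes "finite I" "indep_vars (\<lambda>_. borel) X I" "\<And>i. i \<in> I \<Longrightarrow> integrable M (\<lambda>\<omega>. (X i \<omega>)\<^sup>2)"
  shows "integrable M (\<lambda>\<omega>. (\<Sum>i\<in>I. X i \<omega>)\<^sup>2)"
    and "variance (\<lambda>\<omega>. \<Sum>i\<in>I. X i \<omega>) = (\<Sum>i\<in>I. variance (X i))"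
proof -
  \<comment> \<open>The two claims are proved in one induction: the cross term factorizes only once
    the sum over the smaller set is known to be integrable.\<close>
  have "integrable M (\<lambda>\<omega>. (\<Sum>i\<in>I. X i \<omega>)\<^sup>2) \<and>
    variance (\<lambda>\<omega>. \<Sum>i\<in>I. X i \<omega>) = (\<Sum>i\<in>I. variance (X i))"
    using assms
  proof (induction I rule: finite_induct)
    case empty
    then show ?case by simp
  next
    case (insert i F)
    let ?S = "\<lambda>\<omega>. \<Sum>i\<in>F. X i \<omega>"
    have rv: "X k \<in> borel_measurable M" if "k \<in> insert i F" for k
      using insert.prems(1) that by (auto simp: indep_vars_def)
    then have [measurable]: "X i \<in> borel_measurable M" "?S \<in> borel_measurable M"
      by auto
    have "indep_vars (\<lambda>_. borel) X F"
      by (rule indep_vars_subset[OF insert.prems(1)]) auto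
    then have S2: "integrable M (\<lambda>\<omega>. (?S \<omega>)\<^sup>2)"
      and IH: "variance ?S = (\<Sum>i\<in>F. variance (X i))"
      using insert by auto
    have X2: "integrable M (\<lambda>\<omega>. (X i \<omega>)\<^sup>2)" using insert.prems by auto
    have X1: "integrable M (X i)" and S1: "integrable M ?S"
      by (rule square_integrable_imp_integrable[OF _ X2], simp, rule square_integrable_imp_integrable[OF _ S2], simp)
    have indep: "indep_var borel (X i) borel ?S"
      using insert by (intro indep_vars_sum) auto
    note XS = indep_var_integrable[OF indep X1 S1] indep_var_lebesgue_integral[OF indep X1 S1]
    have eq: "(X i \<omega> + ?S \<omega>)\<^sup>2 = (X i \<omega>)\<^sup>2 + (?S \<omega>)\<^sup>2 + 2 * (X i \<omega> * ?S \<omega>)" for \<omega>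
      by (simp add: power2_sum)
    have int: "integrable M (\<lambda>\<omega>. (X i \<omega> + ?S \<omega>)\<^sup>2)"
      unfolding eq using X2 S2 XS(1) by (intro Bochner_Integration.integrable_add) auto
    have E: "expectation (\<lambda>\<omega>. (X i \<omega> + ?S \<omega>)\<^sup>2)
        = expectation (\<lambda>\<omega>. (X i \<omega>)\<^sup>2) + expectation (\<lambda>\<omega>. (?S \<omega>)\<^sup>2) + 2 * (expectation (X i) * expectation ?S)"
      unfolding eq using X2 S2 XS by simp
    have "variance (\<lambda>\<omega>. X i \<omega> + ?S \<omega>)
        = expectation (\<lambda>\<omega>. (X i \<omega> + ?S \<omega>)\<^sup>2) - (expectation (\<lambda>\<omega>. X i \<omega> + ?S \<omega>))\<^sup>2"
      using X1 S1 int by (intro variance_eq) auto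
    also have "\<dots> = variance (X i) + variance ?S"
      unfolding E variance_eq[OF X1 X2] variance_eq[OF S1 S2] using X1 S1 by (simp add: power2_sum)
    finally have "variance (\<lambda>\<omega>. X i \<omega> + ?S \<omega>) = variance (X i) + variance ?S" .
    then show ?case using insert.hyps int IH by simp
  qed
  then show "integrable M (\<lambda>\<omega>. (\<Sum>i\<in>I. X i \<omega>)\<^sup>2)"
    "variance (\<lambda>\<omega>. \<Sum>i\<in>I. X i \<omega>) = (\<Sum>i\<in>I. variance (X i))" by auto
qed

text \<open>For c = 0 both sides are 1 by the convention for division by zero, so scaling by a
  standard deviation calls for no case distinction.\<close>

lemma char_distr_affine:
  assumes [measurable]: "random_variable borel X"
  shows "char (distr M borel (\<lambda>\<omega>. (X \<omega> - a) / c)) t = iexp (- (t * a / c)) * char (distr M borel X) (t / c)"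
proof -
  have eq: "iexp (t * ((X \<omega> - a) / c)) = iexp (- (t * a / c)) * iexp (t / c * X \<omega>)" for \<omega>
    by (simp add: exp_add[symmetric] diff_divide_distrib right_diff_distrib)
  have char_X: "char (distr M borel X) (t / c) = expectation (\<lambda>\<omega>. iexp (t / c * X \<omega>))"
    unfolding char_def by (rule integral_distr) auto
  have "char (distr M borel (\<lambda>\<omega>. (X \<omega> - a) / c)) t = expectation (\<lambda>\<omega>. iexp (t * ((X \<omega> - a) / c)))"
    unfolding char_def by (rule integral_distr) auto
  also have "\<dots> = iexp (- (t * a / c)) * expectation (\<lambda>\<omega>. iexp (t / c * X \<omega>))"
    unfolding eq by (rule integral_mult_right_zero)
  finally show ?thesis unfolding char_X .
qed

text \<open>The Taylor remainder is bounded by a minimum of a quadratic and a cubic term. The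
  quadratic one is used where |X| >= \<open>\<epsilon>\<close>; below that level one factor |X| of
  the cubic one is replaced by \<open>\<epsilon>\<close>.\<close>

lemma char_taylor_tail_bound:
  assumes [measurable]: "random_variable borel X"
    and X: "integrable M (\<lambda>\<omega>. (X \<omega>)\<^sup>2)" "expectation X = 0" and \<epsilon>: "\<epsilon> \<ge> 0"
  shows "cmod (char (distr M borel X) t - (1 - t\<^sup>2 * expectation (\<lambda>\<omega>. (X \<omega>)\<^sup>2) / 2))
    \<le> t\<^sup>2 * expectation (\<lambda>\<omega>. (X \<omega>)\<^sup>2 * indicator {x. \<bar>x\<bar> \<ge> \<epsilon>} (X \<omega>))
      + \<bar>t\<bar> ^ 3 * \<epsilon> / 6 * expectation (\<lambda>\<omega>. (X \<omega>)\<^sup>2)"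
proof -
  have X1: "integrable M X" using X(1) by (rule square_integrable_imp_integrable[rotated]) simp
  have int_tail: "integrable M (\<lambda>\<omega>. (X \<omega>)\<^sup>2 * indicator {x. \<bar>x\<bar> \<ge> \<epsilon>} (X \<omega>))"
    by (rule Bochner_Integration.integrable_bound[OF X(1)]) (auto simp: indicator_def)
  have int_min: "integrable M (\<lambda>\<omega>. min (6 * (X \<omega>)\<^sup>2) (\<bar>t\<bar> * \<bar>X \<omega>\<bar> ^ 3))"
    by (rule Bochner_Integration.integrable_bound[OF integrable_mult_right[OF X(1), of 6]]) auto
  have min_le: "min (6 * x\<^sup>2) (\<bar>t\<bar> * \<bar>x\<bar> ^ 3)
      \<le> 6 * (x\<^sup>2 * indicator {x. \<bar>x\<bar> \<ge> \<epsilon>} x) + \<bar>t\<bar> * \<epsilon> * x\<^sup>2" for x :: real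
  proof (cases "\<bar>x\<bar> \<ge> \<epsilon>")
    case True
    then show ?thesis using \<epsilon> by (simp add: min_le_iff_disj)
  next
    case False
    then have "\<bar>t\<bar> * (\<bar>x\<bar> * \<bar>x\<bar>\<^sup>2) \<le> \<bar>t\<bar> * (\<epsilon> * \<bar>x\<bar>\<^sup>2)"
      by (intro mult_left_mono mult_right_mono) auto
    then show ?thesis using False by (simp add: min_le_iff_disj power3_eq_cube power2_eq_square ac_simps)
  qed
  have "expectation (\<lambda>\<omega>. min (6 * (X \<omega>)\<^sup>2) (\<bar>t\<bar> * \<bar>X \<omega>\<bar> ^ 3))
      \<le> expectation (\<lambda>\<omega>. 6 * ((X \<omega>)\<^sup>2 * indicator {x. \<bar>x\<bar> \<ge> \<epsilon>} (X \<omega>)) + \<bar>t\<bar> * \<epsilon> * (X \<omega>)\<^sup>2)"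
    using int_min int_tail X(1) min_le by (intro integral_mono) auto
  also have "\<dots> = 6 * expectation (\<lambda>\<omega>. (X \<omega>)\<^sup>2 * indicator {x. \<bar>x\<bar> \<ge> \<epsilon>} (X \<omega>))
      + \<bar>t\<bar> * \<epsilon> * expectation (\<lambda>\<omega>. (X \<omega>)\<^sup>2)"
    using int_tail X(1) by simp
  finally have min_bound: "expectation (\<lambda>\<omega>. min (6 * (X \<omega>)\<^sup>2) (\<bar>t\<bar> * \<bar>X \<omega>\<bar> ^ 3)) \<le> \<dots>" .
  have "cmod (char (distr M borel X) t - (1 - t\<^sup>2 * expectation (\<lambda>\<omega>. (X \<omega>)\<^sup>2) / 2))
      \<le> t\<^sup>2 / 6 * expectation (\<lambda>\<omega>. min (6 * (X \<omega>)\<^sup>2) (\<bar>t\<bar> * \<bar>X \<omega>\<bar> ^ 3))"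
    by (rule char_approx3') (use X X1 in auto)
  also have "\<dots> \<le> t\<^sup>2 / 6 * (6 * expectation (\<lambda>\<omega>. (X \<omega>)\<^sup>2 * indicator {x. \<bar>x\<bar> \<ge> \<epsilon>} (X \<omega>))
      + \<bar>t\<bar> * \<epsilon> * expectation (\<lambda>\<omega>. (X \<omega>)\<^sup>2))"
    by (rule mult_left_mono[OF min_bound]) simp
  also have "\<dots> = t\<^sup>2 * expectation (\<lambda>\<omega>. (X \<omega>)\<^sup>2 * indicator {x. \<bar>x\<bar> \<ge> \<epsilon>} (X \<omega>))
      + \<bar>t\<bar> ^ 3 * \<epsilon> / 6 * expectation (\<lambda>\<omega>. (X \<omega>)\<^sup>2)"
    by (simp add: algebra_simps power3_eq_cube power2_eq_square)
  finally show ?thesis .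
qed

text \<open>Factors of modulus at most 1 let the difference of two products be bounded by the sum of
  the differences. Each factor is compared with 1 - t^2 v / 2, where v is the variance of that
  summand; the Gaussian error is of order v^2 <= \<open>\<delta>\<close> v, and the v sum to
  1.\<close>

lemma char_sum_lindeberg_bound:
  fixes X :: "'i \<Rightarrow> 'a \<Rightarrow> real"
  assumes I: "finite I" and indep: "indep_vars (\<lambda>_. borel) X I"
    and X: "\<And>i. i \<in> I \<Longrightarrow> integrable M (\<lambda>\<omega>. (X i \<omega>)\<^sup>2)" "\<And>i. i \<in> I \<Longrightarrow> expectation (X i) = 0"
    and var: "(\<Sum>i\<in>I. expectation (\<lambda>\<omega>. (X i \<omega>)\<^sup>2)) = 1"
    and \<delta>: "\<And>i. i \<in> I \<Longrightarrow> expectation (\<lambda>\<omega>. (X i \<omega>)\<^sup>2) \<le> \<delta>" and \<epsilon>: "\<epsilon> \<ge> 0"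
  shows "cmod (char (distr M borel (\<lambda>\<omega>. \<Sum>i\<in>I. X i \<omega>)) t - of_real (exp (- (t\<^sup>2 / 2))))
    \<le> t\<^sup>2 * (\<Sum>i\<in>I. expectation (\<lambda>\<omega>. (X i \<omega>)\<^sup>2 * indicator {x. \<bar>x\<bar> \<ge> \<epsilon>} (X i \<omega>)))
      + \<bar>t\<bar> ^ 3 * \<epsilon> / 6 + t ^ 4 * \<delta> / 8"
proof -
  let ?v = "\<lambda>i. expectation (\<lambda>\<omega>. (X i \<omega>)\<^sup>2)"
  let ?L = "\<lambda>i. expectation (\<lambda>\<omega>. (X i \<omega>)\<^sup>2 * indicator {x. \<bar>x\<bar> \<ge> \<epsilon>} (X i \<omega>))"
  let ?\<phi> = "\<lambda>i. char (distr M borel (X i)) t" and ?\<psi> = "\<lambda>i. exp (- (t\<^sup>2 * ?v i / 2))"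
  have rv: "X i \<in> borel_measurable M" if "i \<in> I" for i
    using indep that by (auto simp: indep_vars_def)
  have v_nonneg: "?v i \<ge> 0" for i by simp
  \<comment> \<open>As the variances sum to 1, the Gaussian splits into one factor per summand with
    matching variance.\<close>
  have "of_real (exp (- (t\<^sup>2 / 2))) = complex_of_real (exp (\<Sum>i\<in>I. - (t\<^sup>2 * ?v i / 2)))"
    by (simp add: sum_negf var flip: sum_divide_distrib sum_distrib_left)
  also have "\<dots> = (\<Prod>i\<in>I. complex_of_real (?\<psi> i))"
    using I by (simp add: exp_sum)
  finally have "cmod (char (distr M borel (\<lambda>\<omega>. \<Sum>i\<in>I. X i \<omega>)) t - of_real (exp (- (t\<^sup>2 / 2))))
      = cmod ((\<Prod>i\<in>I. ?\<phi> i) - (\<Prod>i\<in>I. complex_of_real (?\<psi> i)))"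
    using char_distr_sum[OF indep] by simp
  also have "\<dots> \<le> (\<Sum>i\<in>I. cmod (?\<phi> i - of_real (?\<psi> i)))"
  proof (rule norm_prod_diff)
    fix i assume "i \<in> I"
    then interpret D: real_distribution "distr M borel (X i)"
      using rv by (intro real_distribution_distr)
    show "cmod (?\<phi> i) \<le> 1" by (rule D.cmod_char_le_1)
    show "cmod (of_real (?\<psi> i)) \<le> 1" by simp
  qed
  also have "\<dots> \<le> (\<Sum>i\<in>I. t\<^sup>2 * ?L i + \<bar>t\<bar> ^ 3 * \<epsilon> / 6 * ?v i + t ^ 4 * \<delta> / 8 * ?v i)"
  proof (rule sum_mono)
    fix i assume i: "i \<in> I"
    have "cmod (?\<phi> i - of_real (?\<psi> i)) \<le> cmod (?\<phi> i - (1 - t\<^sup>2 * ?v i / 2))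
        + cmod (of_real (?\<psi> i) - (1 - t\<^sup>2 * ?v i / 2))"
      using norm_triangle_ineq4[of "?\<phi> i - (1 - t\<^sup>2 * ?v i / 2)" "of_real (?\<psi> i) - (1 - t\<^sup>2 * ?v i / 2)"]
      by simp
    also have "cmod (?\<phi> i - (1 - t\<^sup>2 * ?v i / 2)) \<le> t\<^sup>2 * ?L i + \<bar>t\<bar> ^ 3 * \<epsilon> / 6 * ?v i"
      using i X rv \<epsilon> by (intro char_taylor_tail_bound) auto
    also have "cmod (of_real (?\<psi> i) - (1 - t\<^sup>2 * ?v i / 2)) = \<bar>?\<psi> i - (1 - t\<^sup>2 * ?v i / 2)\<bar>"
    proof -
      have "of_real (?\<psi> i) - (1 - t\<^sup>2 * ?v i / 2) = complex_of_real (?\<psi> i - (1 - t\<^sup>2 * ?v i / 2))"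
        by simp
      then show ?thesis by (simp only: norm_of_real)
    qed
    also have "\<dots> \<le> (t\<^sup>2 * ?v i / 2)\<^sup>2 / 2"
      by (rule abs_exp_minus_taylor1) simp
    also have "\<dots> = t ^ 4 / 8 * (?v i * ?v i)"
      by (simp add: power2_eq_square power4_eq_xxxx)
    also have "\<dots> \<le> t ^ 4 / 8 * (\<delta> * ?v i)"
      using \<delta>[OF i] by (intro mult_left_mono mult_right_mono) auto
    finally show "cmod (?\<phi> i - of_real (?\<psi> i))
        \<le> t\<^sup>2 * ?L i + \<bar>t\<bar> ^ 3 * \<epsilon> / 6 * ?v i + t ^ 4 * \<delta> / 8 * ?v i"
      by simp
  qed
  also have "\<dots> = t\<^sup>2 * (\<Sum>i\<in>I. ?L i) + \<bar>t\<bar> ^ 3 * \<epsilon> / 6 + t ^ 4 * \<delta> / 8"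
    unfolding sum.distrib sum_distrib_left[symmetric] var by simp
  finally show ?thesis .
qed

lemma normal_or_degenerate_of_char:
  assumes [measurable]: "random_variable borel X" and b: "b \<ge> 0"
    and char: "\<And>t. char (distr M borel X) t = iexp (t * a) * of_real (exp (- (b * t\<^sup>2)))"
  shows "degenerate_rv M X \<or> normal_rv M X"
proof (cases "b = 0")
  case True
  interpret R: prob_space "return borel a" by (rule prob_space_return) simp
  have distr_eq: "distr M borel X = return borel a"
  proof (rule Levy_uniqueness)
    show "real_distribution (distr M borel X)" by (rule real_distribution_distr) measurable
    show "real_distribution (return borel a)" by unfold_locales auto
    show "char (distr M borel X) = char (return borel a)"
    proof
      fix t
      have "char (return borel a) t = iexp (t * a)"
        unfolding char_def by (rule integral_return) auto
      then show "char (distr M borel X) t = char (return borel a) t" using True by (simp add: char)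
    qed
  qed
  have "AE x in distr M borel X. x = a" unfolding distr_eq by (subst AE_return) auto
  then have "AE \<omega> in M. X \<omega> = a" by (simp add: AE_distr_iff)
  then show ?thesis unfolding degenerate_rv_def by blast
next
  case False
  \<comment> \<open>The factor exp (-b t^2) belongs to variance 2 b, so this s standardizes
    \<open>X\<close>.\<close>
  define s where "s = sqrt (2 * b)"
  have s: "s > 0" "s\<^sup>2 = 2 * b" using False b by (auto simp: s_def)
  have "distr M borel (\<lambda>\<omega>. (X \<omega> - a) / s) = std_normal_distribution"
  proof (rule Levy_uniqueness[OF _ real_dist_normal_dist])
    show "real_distribution (distr M borel (\<lambda>\<omega>. (X \<omega> - a) / s))" by (rule real_distribution_distr) measurable
    show "char (distr M borel (\<lambda>\<omega>. (X \<omega> - a) / s)) = char std_normal_distribution"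
    proof
      fix t
      have "b * (t / s)\<^sup>2 = t\<^sup>2 / 2" using s False by (simp add: power_divide)
      moreover have "iexp (- (t * a / s)) * iexp (t / s * a) = 1"
        by (simp add: exp_add[symmetric])
      moreover have "char (distr M borel (\<lambda>\<omega>. (X \<omega> - a) / s)) t
          = iexp (- (t * a / s)) * iexp (t / s * a) * of_real (exp (- (b * (t / s)\<^sup>2)))"
        by (simp only: char_distr_affine[OF assms(1)] char mult.assoc)
      ultimately have "char (distr M borel (\<lambda>\<omega>. (X \<omega> - a) / s)) t = of_real (exp (- (t\<^sup>2 / 2)))"
        by (simp only: mult_1)
      then show "char (distr M borel (\<lambda>\<omega>. (X \<omega> - a) / s)) t = char std_normal_distribution t"
        by (simp add: char_std_normal_distribution)
    qed
  qed
  then have "distributed M lborel (\<lambda>\<omega>. (X \<omega> - a) / s) std_normal_density"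
    by (auto simp: distributed_def cong: distr_cong)
  then have "distributed M lborel X (normal_density a s)"
    using normal_standard_normal_convert[OF s(1)] by simp
  then show ?thesis unfolding normal_rv_def using s by blast
qed

end

lemma tight_of_second_moment_le_1:
  assumes M: "\<And>n. real_distribution (\<mu> n)"
    and int: "\<And>n. integrable (\<mu> n) (\<lambda>x. x\<^sup>2)" and le: "\<And>n. (\<integral>x. x\<^sup>2 \<partial>\<mu> n) \<le> 1"
  shows "tight \<mu>"
  unfolding tight_def
proof (intro conjI allI impI M)
  fix e :: real assume e: "e > 0"
  \<comment> \<open>Chebyshev's inequality leaves mass at most 1 / c^2 outside the interval; c > 1
    gives 1 / c^2 <= 1 / c < e.\<close>
  define c where "c = 1 / e + 1"
  have c: "c > 1" using e by (simp add: c_def)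
  have "1 / c\<^sup>2 \<le> 1 / c"
    using c by (intro divide_left_mono) (auto simp: power2_eq_square)
  also have "1 / c < e" using e by (simp add: c_def field_simps)
  finally have ce: "1 / c\<^sup>2 < e" .
  have "1 - e < measure (\<mu> n) {- c<..c}" for n
  proof -
    interpret real_distribution "\<mu> n" by (rule M)
    have "c\<^sup>2 * prob (- {- c<..c}) = expectation (\<lambda>x. c\<^sup>2 * indicator (- {- c<..c}) x)"
      by simp
    also have "\<dots> \<le> expectation (\<lambda>x. x\<^sup>2)"
    proof (intro integral_mono int)
      show "c\<^sup>2 * indicator (- {- c<..c}) x \<le> x\<^sup>2" for x
        using c by (auto simp: indicator_def not_le not_less abs_le_square_iff[symmetric])
    qed (auto intro!: integrable_real_indicator integrable_mult_right simp: less_top[symmetric])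
    also have "\<dots> \<le> 1" by (rule le)
    finally have "prob (- {- c<..c}) \<le> 1 / c\<^sup>2" using c by (simp add: field_simps)
    then show ?thesis using ce prob_compl[of "{- c<..c}"] by (simp add: Compl_eq_Diff_UNIV)
  qed
  then show "\<exists>a b. a < b \<and> (\<forall>n. 1 - e < measure (\<mu> n) {a<..b})"
    using c by (intro exI[of _ "-c"] exI[of _ c]) auto
qed

section \<open>Normalized sums of independent variables\<close>

locale independent_square_integrable_sequence = prob_space +
  fixes \<xi> :: "nat \<Rightarrow> 'a \<Rightarrow> real"
  assumes indep: "indep_vars (\<lambda>_. borel) \<xi> {1..}"
    and square_integrable: "square_integrable_seq M \<xi>"
begin

abbreviation m :: "nat \<Rightarrow> real" where "m k \<equiv> expectation (\<xi> k)"
abbreviation v :: "nat \<Rightarrow> real" where "v k \<equiv> variance (\<xi> k)"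
abbreviation V :: "nat \<Rightarrow> real" where "V \<equiv> total_variance M \<xi>"

lemma rv: "k \<ge> 1 \<Longrightarrow> random_variable borel (\<xi> k)"
  using indep by (auto simp: indep_vars_def)

lemma integrable_square: "k \<ge> 1 \<Longrightarrow> integrable M (\<lambda>\<omega>. (\<xi> k \<omega>)\<^sup>2)"
  using square_integrable by (auto simp: square_integrable_seq_def)

lemma integrable: "k \<ge> 1 \<Longrightarrow> integrable M (\<xi> k)"
  using square_integrable_imp_integrable[OF rv integrable_square] .

lemma integrable_centered_square: "k \<ge> 1 \<Longrightarrow> integrable M (\<lambda>\<omega>. (\<xi> k \<omega> - m k)\<^sup>2)"
  using integrable_square integrable by (simp add: power2_diff)

lemma total_variance_eq: "V n = (\<Sum>k=1..n. v k)"
  unfolding total_variance_def partial_sum_def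
  by (rule variance_sum_indep(2)) (auto intro: indep_vars_subset[OF indep] integrable_square)

lemma mono_total_variance: "mono V"
  unfolding total_variance_eq by (intro monoI sum_mono2) auto

lemma total_variance_nonneg: "V n \<ge> 0"
  unfolding total_variance_eq by (intro sum_nonneg) simp

lemma variance_le_total: "1 \<le> k \<Longrightarrow> k \<le> n \<Longrightarrow> v k \<le> V n"
  unfolding total_variance_eq by (rule member_le_sum) auto

lemma normalized_sum_eq:
  "normalized_sum M \<xi> n = (\<lambda>\<omega>. \<Sum>k=1..n. (\<xi> k \<omega> - m k) / sqrt (V n))"
proof -
  have "expectation (partial_sum \<xi> n) = (\<Sum>k=1..n. m k)"
    unfolding partial_sum_def using integrable by (intro Bochner_Integration.integral_sum) auto
  then show ?thesis
    by (simp add: normalized_sum_def partial_sum_def sum_subtractf flip: sum_divide_distrib)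
qed

lemma indep_scaled: "J \<subseteq> {1..} \<Longrightarrow> indep_vars (\<lambda>_. borel) (\<lambda>k \<omega>. (\<xi> k \<omega> - m k) / c) J"
  by (rule indep_vars_compose2[OF indep_vars_subset[OF indep], where Y = "\<lambda>k x. (x - m k) / c"]) auto

lemma scaled_moments:
  assumes "k \<ge> 1"
  shows "integrable M (\<lambda>\<omega>. ((\<xi> k \<omega> - m k) / c)\<^sup>2)"
    and "expectation (\<lambda>\<omega>. (\<xi> k \<omega> - m k) / c) = 0"
    and "expectation (\<lambda>\<omega>. ((\<xi> k \<omega> - m k) / c)\<^sup>2) = v k / c\<^sup>2"
  using integrable_centered_square[OF assms] integrable[OF assms]
  by (simp_all add: power_divide prob_space)

text \<open>Multiplying by the variance undoes the normalization of the tail ratio. At variance 0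
  the truncated moment vanishes too, being squeezed between 0 and the variance, so later sums need
  not separate degenerate summands.\<close>

lemma tail_moment_eq:
  assumes k: "k \<ge> 1"
  shows "expectation (\<lambda>\<omega>. (\<xi> k \<omega> - m k)\<^sup>2 * indicator {x. \<bar>x\<bar> \<ge> s} (\<xi> k \<omega> - m k)) = tail_ratio M \<xi> k s * v k"
proof (cases "v k = 0")
  case True
  have [measurable]: "random_variable borel (\<xi> k)" using rv[OF k] .
  have "expectation (\<lambda>\<omega>. (\<xi> k \<omega> - m k)\<^sup>2 * indicator {x. \<bar>x\<bar> \<ge> s} (\<xi> k \<omega> - m k)) \<le> v k"
    by (rule integral_mono'[OF integrable_centered_square[OF k]]) (auto simp: indicator_def)
  moreover have "expectation (\<lambda>\<omega>. (\<xi> k \<omega> - m k)\<^sup>2 * indicator {x. \<bar>x\<bar> \<ge> s} (\<xi> k \<omega> - m k)) \<ge> 0"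
    by simp
  ultimately show ?thesis using True by (simp add: tail_ratio_def)
next
  case False
  have [measurable]: "random_variable borel (\<xi> k)" using rv[OF k] .
  have "(LINT x:{x. \<bar>x - m k\<bar> \<ge> s}|distr M borel (\<xi> k). \<bar>x - m k\<bar>\<^sup>2)
      = expectation (\<lambda>\<omega>. indicator {x. \<bar>x - m k\<bar> \<ge> s} (\<xi> k \<omega>) *\<^sub>R \<bar>\<xi> k \<omega> - m k\<bar>\<^sup>2)"
    unfolding set_lebesgue_integral_def by (rule integral_distr) auto
  also have "\<dots> = expectation (\<lambda>\<omega>. (\<xi> k \<omega> - m k)\<^sup>2 * indicator {x. \<bar>x\<bar> \<ge> s} (\<xi> k \<omega> - m k))"
    by (intro Bochner_Integration.integral_cong) (auto simp: indicator_def)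
  finally show ?thesis using False by (simp add: tail_ratio_def Let_def)
qed

section \<open>Sufficiency: Lindeberg's comparison\<close>

text \<open>A tail of the scaled summand at level \<open>\<epsilon>\<close> is a tail of the
  centered one at level \<open>\<epsilon> * sqrt (V n)\<close>. The weights \<open>v k / V n\<close>
  sum to 1, so a common bound on the tail ratios bounds the whole Lindeberg sum.\<close>

lemma char_normalized_sum_bound:
  assumes V: "V n > 0" and \<epsilon>: "\<epsilon> \<ge> 0"
    and A: "\<And>k. k \<ge> 1 \<Longrightarrow> tail_ratio M \<xi> k (\<epsilon> * sqrt (V n)) \<le> A"
    and C: "\<And>k. k \<ge> 1 \<Longrightarrow> v k \<le> C"
  shows "cmod (char (distr M borel (normalized_sum M \<xi> n)) t - of_real (exp (- (t\<^sup>2 / 2))))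
    \<le> t\<^sup>2 * A + \<bar>t\<bar> ^ 3 * \<epsilon> / 6 + t ^ 4 * (C / V n) / 8"
proof -
  let ?B = "sqrt (V n)"
  let ?X = "\<lambda>k \<omega>. (\<xi> k \<omega> - m k) / ?B"
  have B: "?B > 0" "?B\<^sup>2 = V n" using V by auto
  have tail: "expectation (\<lambda>\<omega>. (?X k \<omega>)\<^sup>2 * indicator {x. \<bar>x\<bar> \<ge> \<epsilon>} (?X k \<omega>)) \<le> A * v k / V n"
    if "k \<in> {1..n}" for k
  proof -
    have "(?X k \<omega>)\<^sup>2 * indicator {x. \<bar>x\<bar> \<ge> \<epsilon>} (?X k \<omega>)
        = (\<xi> k \<omega> - m k)\<^sup>2 * indicator {x. \<bar>x\<bar> \<ge> \<epsilon> * ?B} (\<xi> k \<omega> - m k) / V n" for \<omega>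
      using V by (auto simp: indicator_def power_divide abs_divide field_simps)
    then have "expectation (\<lambda>\<omega>. (?X k \<omega>)\<^sup>2 * indicator {x. \<bar>x\<bar> \<ge> \<epsilon>} (?X k \<omega>))
        = tail_ratio M \<xi> k (\<epsilon> * ?B) * v k / V n"
      using tail_moment_eq[of k "\<epsilon> * ?B"] that by simp
    also have "\<dots> \<le> A * v k / V n"
      using V A[of k] that by (intro divide_right_mono mult_right_mono) auto
    finally show ?thesis .
  qed
  have "cmod (char (distr M borel (\<lambda>\<omega>. \<Sum>k=1..n. ?X k \<omega>)) t - of_real (exp (- (t\<^sup>2 / 2))))
    \<le> t\<^sup>2 * (\<Sum>k=1..n. expectation (\<lambda>\<omega>. (?X k \<omega>)\<^sup>2 * indicator {x. \<bar>x\<bar> \<ge> \<epsilon>} (?X k \<omega>)))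
      + \<bar>t\<bar> ^ 3 * \<epsilon> / 6 + t ^ 4 * (C / V n) / 8"
  proof (rule char_sum_lindeberg_bound)
    show "indep_vars (\<lambda>_. borel) ?X {1..n}" by (rule indep_scaled) auto
    show "(\<Sum>k=1..n. expectation (\<lambda>\<omega>. (?X k \<omega>)\<^sup>2)) = 1"
      using V B by (simp add: scaled_moments total_variance_eq flip: sum_divide_distrib)
    show "expectation (\<lambda>\<omega>. (?X k \<omega>)\<^sup>2) \<le> C / V n" if "k \<in> {1..n}" for k
      using that V B C by (simp add: scaled_moments divide_right_mono)
  qed (use \<epsilon> scaled_moments in auto)
  also have "(\<Sum>k=1..n. expectation (\<lambda>\<omega>. (?X k \<omega>)\<^sup>2 * indicator {x. \<bar>x\<bar> \<ge> \<epsilon>} (?X k \<omega>))) \<le> (\<Sum>k=1..n. A * v k / V n)"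
    by (rule sum_mono[OF tail])
  also have "\<dots> = A"
    using V by (simp add: total_variance_eq flip: sum_divide_distrib sum_distrib_left)
  finally show ?thesis by (simp add: normalized_sum_eq mult_left_mono)
qed

lemma tail_ratio_le_SUP:
  assumes "k \<ge> 1"
  shows "tail_ratio M \<xi> k s \<le> (SUP n\<in>{1..}. tail_ratio M \<xi> n s)"
proof (rule cSUP_upper)
  show "bdd_above ((\<lambda>n. tail_ratio M \<xi> n s) ` {1..})"
    using tail_ratio_le_1[OF prob_space_axioms] rv integrable_square
    by (intro bdd_aboveI[of _ 1]) auto
qed (use assms in simp)

text \<open>At a level s where all tail ratios are below 1/2, the tail carries at most half of each
  variance and the remainder at most s^2; hence every variance is at most 2 s^2.\<close>

lemma variance_bounded:
  assumes "uniform_convergence_condition M \<xi>"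
  obtains C where "\<And>k. k \<ge> 1 \<Longrightarrow> v k \<le> C"
proof -
  have "\<forall>\<^sub>F s in at_top. (SUP n\<in>{1..}. tail_ratio M \<xi> n s) < 1 / 2"
    using assms by (intro order_tendstoD) (auto simp: uniform_convergence_condition_def)
  then obtain s where s: "(SUP n\<in>{1..}. tail_ratio M \<xi> n s) < 1 / 2"
    by (metis eventually_at_top_linorder order_refl)
  have "v k \<le> 2 * s\<^sup>2" if k: "k \<ge> 1" for k
  proof -
    have [measurable]: "random_variable borel (\<xi> k)" using rv[OF k] .
    let ?T = "\<lambda>\<omega>. (\<xi> k \<omega> - m k)\<^sup>2 * indicator {x. \<bar>x\<bar> \<ge> s} (\<xi> k \<omega> - m k)"
    have T: "Bochner_Integration.integrable M ?T"
      by (rule Bochner_Integration.integrable_bound[OF integrable_centered_square[OF k]])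
         (auto simp: indicator_def)
    have "(\<xi> k \<omega> - m k)\<^sup>2 \<le> s\<^sup>2 + ?T \<omega>" for \<omega>
      by (auto simp: indicator_def abs_le_square_iff[symmetric])
    then have "v k \<le> expectation (\<lambda>\<omega>. s\<^sup>2 + ?T \<omega>)"
      using T integrable_centered_square[OF k] by (intro integral_mono) auto
    also have "\<dots> = s\<^sup>2 + tail_ratio M \<xi> k s * v k"
      using T tail_moment_eq[OF k] by (simp add: prob_space)
    also have "\<dots> \<le> s\<^sup>2 + 1 / 2 * v k"
      using s tail_ratio_le_SUP[OF k, of s] by (intro add_left_mono mult_right_mono) auto
    finally show ?thesis by simp
  qed
  then show ?thesis using that by blast
qed

lemma normalized_sum_measurable: "random_variable borel (normalized_sum M \<xi> n)"
  unfolding normalized_sum_eq using rv by (intro borel_measurable_sum borel_measurable_divide borel_measurable_diff) auto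

lemma normalized_sum_weak_conv:
  assumes unif: "uniform_convergence_condition M \<xi>" and V: "filterlim V at_top sequentially"
  shows "weak_conv_m (\<lambda>n. distr M borel (normalized_sum M \<xi> n)) std_normal_distribution"
proof (rule levy_continuity)
  show "real_distribution (distr M borel (normalized_sum M \<xi> n))" for n
    by (rule real_distribution_distr[OF normalized_sum_measurable])
  show "real_distribution std_normal_distribution" by (rule real_dist_normal_dist)
  fix t :: real
  define A where "A s = (SUP n\<in>{1..}. tail_ratio M \<xi> n s)" for s
  have A: "(A \<longlongrightarrow> 0) at_top"
    using unif unfolding A_def uniform_convergence_condition_def by simp
  obtain C where C: "\<And>k. k \<ge> 1 \<Longrightarrow> v k \<le> C" using variance_bounded[OF unif] by blast
  \<comment> \<open>With \<open>\<epsilon>\<close> = 1 / \<open>r n\<close> the truncation level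
    \<open>\<epsilon> * sqrt (V n)\<close> equals \<open>r n\<close>. So \<open>\<epsilon>\<close>
    tends to 0 while the level tends to infinity, and one limit replaces two successive
    ones.\<close>
  define r where "r n = sqrt (sqrt (V n))" for n
  have r: "filterlim r at_top sequentially"
    unfolding r_def by (intro filterlim_compose[OF sqrt_at_top] V)
  let ?bound = "\<lambda>n. t\<^sup>2 * A (r n) + \<bar>t\<bar> ^ 3 * (1 / r n) / 6 + t ^ 4 * (C / V n) / 8"
  have "?bound \<longlonglongrightarrow> t\<^sup>2 * 0 + \<bar>t\<bar> ^ 3 * 0 / 6 + t ^ 4 * 0 / 8"
    by (intro tendsto_intros filterlim_compose[OF A r] tendsto_divide_0[OF tendsto_const]
        filterlim_at_top_imp_at_infinity r V) auto
  then have "?bound \<longlonglongrightarrow> 0" by simp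
  moreover have "\<forall>\<^sub>F n in sequentially.
      cmod (char (distr M borel (normalized_sum M \<xi> n)) t - of_real (exp (- (t\<^sup>2 / 2)))) \<le> ?bound n"
    using filterlim_at_top_dense[THEN iffD1, OF V, rule_format, of 0]
  proof eventually_elim
    fix n assume n: "0 < V n"
    have "1 / r n * sqrt (V n) = r n" using n by (simp add: r_def field_simps)
    then show "cmod (char (distr M borel (normalized_sum M \<xi> n)) t - of_real (exp (- (t\<^sup>2 / 2)))) \<le> ?bound n"
      using n C tail_ratio_le_SUP unfolding A_def
      by (intro char_normalized_sum_bound) (auto simp: r_def)
  qed
  ultimately have "(\<lambda>n. char (distr M borel (normalized_sum M \<xi> n)) t - of_real (exp (- (t\<^sup>2 / 2)))) \<longlonglongrightarrow> 0"
    by (rule Lim_null_comparison[rotated])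
  then show "(\<lambda>n. char (distr M borel (normalized_sum M \<xi> n)) t) \<longlonglongrightarrow> char std_normal_distribution t"
    by (simp add: char_std_normal_distribution LIM_zero_iff)
qed

section \<open>Necessity: bounded total variance\<close>

lemma scaled_partial_sum_second_moment:
  assumes J: "J \<subseteq> {1..n}"
  shows "integrable M (\<lambda>\<omega>. (\<Sum>k\<in>J. (\<xi> k \<omega> - m k) / sqrt (V n))\<^sup>2)"
    and "expectation (\<lambda>\<omega>. (\<Sum>k\<in>J. (\<xi> k \<omega> - m k) / sqrt (V n))\<^sup>2) \<le> 1"
proof -
  let ?X = "\<lambda>k \<omega>. (\<xi> k \<omega> - m k) / sqrt (V n)"
  have fin: "finite J" and J1: "\<And>k. k \<in> J \<Longrightarrow> k \<ge> 1" using J finite_subset by auto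
  have ind: "indep_vars (\<lambda>_. borel) ?X J" using J1 by (intro indep_scaled) auto
  note var = variance_sum_indep[OF fin ind scaled_moments(1)[OF J1]]
  show "integrable M (\<lambda>\<omega>. (\<Sum>k\<in>J. ?X k \<omega>)\<^sup>2)" by (rule var(1))
  have "expectation (\<lambda>\<omega>. \<Sum>k\<in>J. ?X k \<omega>) = (\<Sum>k\<in>J. expectation (?X k))"
    using J1 integrable by (intro Bochner_Integration.integral_sum) auto
  also have "\<dots> = 0" using J1 scaled_moments(2) by (intro sum.neutral) blast
  finally have "expectation (\<lambda>\<omega>. (\<Sum>k\<in>J. ?X k \<omega>)\<^sup>2) = (\<Sum>k\<in>J. variance (?X k))"
    using var(2) by simp
  also have "\<dots> = (\<Sum>k\<in>J. v k / V n)"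
  proof (rule sum.cong[OF refl])
    fix k assume "k \<in> J"
    then have k: "k \<ge> 1" by (rule J1)
    have "variance (?X k) = expectation (\<lambda>\<omega>. (?X k \<omega>)\<^sup>2)"
      by (simp only: scaled_moments(2)[OF k] diff_zero)
    also have "\<dots> = v k / V n"
      using scaled_moments(3)[OF k] total_variance_nonneg by simp
    finally show "variance (?X k) = v k / V n" .
  qed
  also have "\<dots> \<le> (\<Sum>k=1..n. v k / V n)"
    using J total_variance_nonneg by (intro sum_mono2) auto
  \<comment> \<open>The sum is 1 if \<open>V n\<close> is positive and 0 by the division convention
    otherwise.\<close>
  also have "\<dots> \<le> 1"
    by (simp add: total_variance_eq flip: sum_divide_distrib)
  finally show "expectation (\<lambda>\<omega>. (\<Sum>k\<in>J. ?X k \<omega>)\<^sup>2) \<le> 1" .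
qed

lemma normal_or_degenerate_of_bounded_variance:
  assumes conv: "weak_conv_m (\<lambda>n. distr M borel (normalized_sum M \<xi> n)) std_normal_distribution"
    and bounded: "\<And>n. V n \<le> K" and j: "j \<ge> 1" "v j > 0"
  shows "degenerate_rv M (\<xi> j) \<or> normal_rv M (\<xi> j)"
proof -
  have [measurable]: "random_variable borel (\<xi> j)" using rv[OF j(1)] .
  have "bdd_above (range V)" using bounded by (intro bdd_aboveI[of _ K]) auto
  then have V_lim: "V \<longlonglongrightarrow> (SUP n. V n)"
    using mono_total_variance by (intro LIMSEQ_incseq_SUP) auto
  define b where "b = sqrt (SUP n. V n)"
  have "v j \<le> (SUP n. V n)"
    using variance_le_total[OF j(1) order_refl] cSUP_upper[OF UNIV_I \<open>bdd_above (range V)\<close>, of j] by simp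
  then have b: "b > 0" using j(2) by (simp add: b_def)
  have B_lim: "(\<lambda>n. sqrt (V n)) \<longlonglongrightarrow> b"
    unfolding b_def by (intro tendsto_intros V_lim)

  \<comment> \<open>Scaling by the limit b makes the split-off summand independent of n, while the
    remaining sum \<open>Y n\<close> keeps the scale \<open>sqrt (V n)\<close>.\<close>
  define X where "X \<omega> = (\<xi> j \<omega> - m j) / b" for \<omega>
  have [measurable]: "random_variable borel X" unfolding X_def by measurable
  define Y where "Y n \<omega> = (\<Sum>k\<in>{1..n} - {j}. (\<xi> k \<omega> - m k) / sqrt (V n))" for n \<omega>
  have Y_rv: "random_variable borel (Y n)" for n
    unfolding Y_def using rv by (intro borel_measurable_sum borel_measurable_divide borel_measurable_diff) auto
  let ?\<mu> = "\<lambda>n. distr M borel (Y n)"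
  have "tight ?\<mu>"
  proof (rule tight_of_second_moment_le_1)
    show "real_distribution (?\<mu> n)" for n by (rule real_distribution_distr[OF Y_rv])
    show "integrable (?\<mu> n) (\<lambda>x. x\<^sup>2)" for n
      using scaled_partial_sum_second_moment(1)[of "{1..n} - {j}" n] Y_rv
      by (subst integrable_distr_eq) (auto simp: Y_def)
    show "(\<integral>x. x\<^sup>2 \<partial>?\<mu> n) \<le> 1" for n
      using scaled_partial_sum_second_moment(2)[of "{1..n} - {j}" n] Y_rv
      by (subst integral_distr) (auto simp: Y_def)
  qed
  \<comment> \<open>The laws of \<open>Y n\<close> need not be shown to converge; a limit along one
    subsequence is enough to produce the complementary factor.\<close>
  from tight_imp_convergent_subsubsequence[OF this strict_mono_id]
  obtain r \<nu> where r: "strict_mono r" and \<nu>: "real_distribution \<nu>"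
    and conv_\<nu>: "weak_conv_m (\<lambda>n. ?\<mu> (r n)) \<nu>"
    by (auto simp: comp_def)

  let ?\<phi> = "char (distr M borel (\<xi> j))"
  have split: "char (distr M borel (normalized_sum M \<xi> n)) t
      = iexp (- (t * m j / sqrt (V n))) * ?\<phi> (t / sqrt (V n)) * char (?\<mu> n) t" if "n \<ge> j" for n t
  proof -
    let ?c = "\<lambda>k. char (distr M borel (\<lambda>\<omega>. (\<xi> k \<omega> - m k) / sqrt (V n))) t"
    have "char (distr M borel (normalized_sum M \<xi> n)) t = (\<Prod>k=1..n. ?c k)"
      unfolding normalized_sum_eq by (intro char_distr_sum indep_scaled) auto
    also have "\<dots> = ?c j * (\<Prod>k\<in>{1..n} - {j}. ?c k)"
      using that j by (intro prod.remove) auto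
    also have "(\<Prod>k\<in>{1..n} - {j}. ?c k) = char (?\<mu> n) t"
      unfolding Y_def by (intro char_distr_sum[symmetric] indep_scaled) auto
    finally show ?thesis using char_distr_affine[of "\<xi> j" "m j" "sqrt (V n)" t] by simp
  qed
  interpret \<phi>: real_distribution "distr M borel (\<xi> j)" by (rule real_distribution_distr) measurable
  \<comment> \<open>The characteristic functions of the normalized sums along r have two limits: the
    product, by factorization and continuity, and the Gaussian, by hypothesis.\<close>
  have char_eq: "char (distr M borel X) t * char \<nu> t = char std_normal_distribution t" for t
  proof (rule LIMSEQ_unique)
    have "(\<lambda>n. iexp (- (t * m j / sqrt (V n))) * ?\<phi> (t / sqrt (V n))) \<longlonglongrightarrow>
        iexp (- (t * m j / b)) * ?\<phi> (t / b)"
      using b by (intro tendsto_intros B_lim isCont_tendsto_compose[OF \<phi>.isCont_char]) auto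
    also have "iexp (- (t * m j / b)) * ?\<phi> (t / b) = char (distr M borel X) t"
      unfolding X_def by (rule char_distr_affine[symmetric]) measurable
    finally have "(\<lambda>n. iexp (- (t * m j / sqrt (V n))) * ?\<phi> (t / sqrt (V n))) \<longlonglongrightarrow> char (distr M borel X) t" .
    from LIMSEQ_subseq_LIMSEQ[OF this r]
    show "(\<lambda>n. iexp (- (t * m j / sqrt (V (r n)))) * ?\<phi> (t / sqrt (V (r n))) * char (?\<mu> (r n)) t)
        \<longlonglongrightarrow> char (distr M borel X) t * char \<nu> t"
      unfolding comp_def
      by (intro tendsto_mult levy_continuity1[OF _ \<nu> conv_\<nu>] real_distribution_distr Y_rv)
    have "(\<lambda>n. char (distr M borel (normalized_sum M \<xi> n)) t) \<longlonglongrightarrow> char std_normal_distribution t"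
      by (intro levy_continuity1 conv real_dist_normal_dist real_distribution_distr normalized_sum_measurable)
    from LIMSEQ_subseq_LIMSEQ[OF this r]
    have "(\<lambda>n. char (distr M borel (normalized_sum M \<xi> (r n))) t) \<longlonglongrightarrow> char std_normal_distribution t"
      by (simp add: comp_def)
    moreover have "\<forall>\<^sub>F n in sequentially. char (distr M borel (normalized_sum M \<xi> (r n))) t
        = iexp (- (t * m j / sqrt (V (r n)))) * ?\<phi> (t / sqrt (V (r n))) * char (?\<mu> (r n)) t"
      \<comment> \<open>The factorization requires the j-th summand to be present, which holds since
        r n >= n >= j.\<close>
      using eventually_ge_at_top[of j]
      by eventually_elim (rule split, use seq_suble[OF r] order_trans in blast)
    ultimately show "(\<lambda>n. iexp (- (t * m j / sqrt (V (r n)))) * ?\<phi> (t / sqrt (V (r n))) * char (?\<mu> (r n)) t)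
        \<longlonglongrightarrow> char std_normal_distribution t"
      by (rule Lim_transform_eventually)
  qed
  have "real_distribution (distr M borel X)" by (rule real_distribution_distr) measurable
  from cramer_decomposition_std_normal[OF this \<nu> char_eq] obtain c d
    where "d \<ge> 0" "\<And>t. char (distr M borel X) t = iexp (t * c) * of_real (exp (- (d * t\<^sup>2)))"
    by blast
  then have X_dist: "degenerate_rv M X \<or> normal_rv M X"
    by (intro normal_or_degenerate_of_char) auto
  have \<xi>_eq: "\<xi> j = (\<lambda>\<omega>. m j + b * X \<omega>)" using b by (simp add: X_def fun_eq_iff)
  from X_dist show ?thesis
  proof
    assume "degenerate_rv M X"
    then obtain c where "AE \<omega> in M. X \<omega> = c" by (auto simp: degenerate_rv_def)
    then have "AE \<omega> in M. m j + b * X \<omega> = m j + b * c" by eventually_elim simp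
    then have "degenerate_rv M (\<lambda>\<omega>. m j + b * X \<omega>)" unfolding degenerate_rv_def by blast
    then show ?thesis using \<xi>_eq by simp
  next
    assume "normal_rv M X"
    then obtain c s where "s > 0" "distributed M lborel X (normal_density c s)"
      by (auto simp: normal_rv_def)
    from normal_density_affine[OF this(2,1), of b "m j"] b \<open>s > 0\<close>
    have "normal_rv M (\<lambda>\<omega>. m j + b * X \<omega>)"
      unfolding normal_rv_def by (intro exI[of _ "m j + b * c"] exI[of _ "\<bar>b\<bar> * s"]) auto
    then show ?thesis using \<xi>_eq by simp
  qed
qed

lemma degenerate_of_variance_0:
  assumes k: "k \<ge> 1" "v k = 0"
  shows "degenerate_rv M (\<xi> k)"
proof -
  have "AE \<omega> in M. (\<xi> k \<omega> - m k)\<^sup>2 = 0"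
    using integral_nonneg_eq_0_iff_AE[OF integrable_centered_square[OF k(1)]] k(2) by simp
  then have "AE \<omega> in M. \<xi> k \<omega> = m k" by eventually_elim simp
  then show ?thesis unfolding degenerate_rv_def by blast
qed

lemma total_variance_at_top:
  assumes "weak_conv_m (\<lambda>n. distr M borel (normalized_sum M \<xi> n)) std_normal_distribution"
    and "\<not> singular_seq M \<xi>"
  shows "filterlim V at_top sequentially"
proof (rule ccontr)
  assume "\<not> filterlim V at_top sequentially"
  \<comment> \<open>Failure of divergence gives a bound only for arbitrarily large indices;
    monotonicity of \<open>V\<close> spreads it to all of them.\<close>
  then obtain K where "\<And>N. \<exists>n\<ge>N. V n < K"
    by (auto simp: filterlim_at_top eventually_sequentially not_le)
  then have bounded: "V n \<le> K" for n
    using mono_total_variance by (meson less_imp_le monoD order_trans)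
  obtain j where j: "j \<ge> 1" "\<not> (degenerate_rv M (\<xi> j) \<or> normal_rv M (\<xi> j))"
    using assms(2) by (auto simp: singular_seq_def)
  moreover have "v j > 0"
    using degenerate_of_variance_0[OF j(1)] j(2) variance_positive[of "\<xi> j"] by (auto simp: order_less_le)
  ultimately show False
    using normal_or_degenerate_of_bounded_variance[OF assms(1) bounded] by blast
qed

end

theorem theorem1:
  fixes M :: "'a measure" and \<xi> :: "nat \<Rightarrow> 'a \<Rightarrow> real"
  assumes "prob_space M"
    and "prob_space.indep_vars M (\<lambda>_. borel) \<xi> {1..}"
    and "square_integrable_seq M \<xi>"
    and "\<not> singular_seq M \<xi>"
    and "uniform_convergence_condition M \<xi>"
  shows "weak_conv_m (\<lambda>n. distr M borel (normalized_sum M \<xi> n)) std_normal_distribution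
    \<longleftrightarrow> filterlim (total_variance M \<xi>) at_top sequentially"
proof -
  interpret independent_square_integrable_sequence M \<xi>
    using assms(1-3)
    by (simp add: independent_square_integrable_sequence_def independent_square_integrable_sequence_axioms_def)
  show ?thesis
    using normalized_sum_weak_conv[OF assms(5)] total_variance_at_top[OF _ assms(4)] by blast
qed

end
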